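(* Assume $\mathsf{MA}(\sigma\text{-centered})$. Then there exists a zero-dimensional separable metrizable space $X$ such that $X$ is countable dense homogeneous while $X^2$ is not countable dense homogeneous.
   Context: All spaces are separable metrizable. For a space $X$, $\mathcal{H}(X)$ denotes the group of homeomorphisms of $X$. A space $X$ is countable dense homogeneous ($\mathsf{CDH}$) if for every pair $(A,B)$ of countable dense subsets of $X$ there exists $h\in\mathcal{H}(X)$ with $h[A]=B$. $\mathsf{MA}(\sigma\text{-centered})$ is Martin's Axiom restricted to $\sigma$-centered posets: for every $\sigma$-centered poset $\mathbb{P}$ and every family $\mathcal{D}$ of fewer than $\mathfrak{c}$ dense subsets of $\mathbb{P}$ there is a filter meeting every member of $\mathcal{D}$. *)

theory Defs
  imports "HOL-Analysis.Analysis" "HOL-Library.Equipollence"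
begin

text \<open>A poset is a carrier P with an order le (le q p: q extends p, i.e. q is stronger).\<close>

definition poset_on :: "'p set \<Rightarrow> ('p \<Rightarrow> 'p \<Rightarrow> bool) \<Rightarrow> bool" where
  "poset_on P le \<longleftrightarrow>
     (\<forall>p\<in>P. le p p) \<and>
     (\<forall>p\<in>P. \<forall>q\<in>P. le p q \<and> le q p \<longrightarrow> p = q) \<and>
     (\<forall>p\<in>P. \<forall>q\<in>P. \<forall>r\<in>P. le p q \<and> le q r \<longrightarrow> le p r)"

definition centered_in :: "'p set \<Rightarrow> ('p \<Rightarrow> 'p \<Rightarrow> bool) \<Rightarrow> 'p set \<Rightarrow> bool" where
  "centered_in P le C \<longleftrightarrow> C \<subseteq> P \<and>
     (\<forall>F. finite F \<and> F \<subseteq> C \<longrightarrow> (\<exists>q\<in>P. \<forall>p\<in>F. le q p))"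

definition sigma_centered :: "'p set \<Rightarrow> ('p \<Rightarrow> 'p \<Rightarrow> bool) \<Rightarrow> bool" where
  "sigma_centered P le \<longleftrightarrow>
     (\<exists>C :: nat \<Rightarrow> 'p set. P = (\<Union>n. C n) \<and> (\<forall>n. centered_in P le (C n)))"

definition dense_in_poset :: "'p set \<Rightarrow> ('p \<Rightarrow> 'p \<Rightarrow> bool) \<Rightarrow> 'p set \<Rightarrow> bool" where
  "dense_in_poset P le D \<longleftrightarrow> D \<subseteq> P \<and> (\<forall>p\<in>P. \<exists>q\<in>D. le q p)"

definition poset_filter :: "'p set \<Rightarrow> ('p \<Rightarrow> 'p \<Rightarrow> bool) \<Rightarrow> 'p set \<Rightarrow> bool" where
  "poset_filter P le G \<longleftrightarrow> G \<subseteq> P \<and> G \<noteq> {} \<and>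
     (\<forall>p\<in>G. \<forall>q\<in>P. le p q \<longrightarrow> q \<in> G) \<and>
     (\<forall>p\<in>G. \<forall>q\<in>G. \<exists>r\<in>G. le r p \<and> le r q)"

definition MA_sigma_centered :: bool where
  "MA_sigma_centered \<longleftrightarrow>
     (\<forall>(P :: real set set) le. poset_on P le \<and> sigma_centered P le \<longrightarrow>
       (\<forall>\<D>. \<D> \<prec> (UNIV :: real set) \<and> (\<forall>D\<in>\<D>. dense_in_poset P le D) \<longrightarrow>
          (\<exists>G. poset_filter P le G \<and> (\<forall>D\<in>\<D>. G \<inter> D \<noteq> {}))))"

definition zero_dimensional :: "'a topology \<Rightarrow> bool" where
  "zero_dimensional X \<longleftrightarrow>
     (\<exists>\<B>. (\<forall>U\<in>\<B>. openin X U \<and> closedin X U) \<and>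
          (\<forall>U x. openin X U \<and> x \<in> U \<longrightarrow> (\<exists>V\<in>\<B>. x \<in> V \<and> V \<subseteq> U)))"

definition CDH :: "'a topology \<Rightarrow> bool" where
  "CDH X \<longleftrightarrow>
     (\<forall>A B. countable A \<and> A \<subseteq> topspace X \<and> X closure_of A = topspace X \<and>
            countable B \<and> B \<subseteq> topspace X \<and> X closure_of B = topspace X \<longrightarrow>
        (\<exists>h. homeomorphic_map X X h \<and> h ` A = B))"

end

(* In Z^omega let C be a family of functions well-ordered of type omega_1 by eventual strict
   dominance, and let X consist of all x with x 0 = 0 (a copy of the Baire space) together with all finite
   modifications of members of C. The second part is a lambda-set: every countable subset lies in a
   countable set of the form {x. not g <=* x}, which is a relative G_delta since its complement is the
   union of the closed sets {x. g k <= x k for all k >= m}.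

   X is CDH: given countable dense D and E, choose a countable S containing both and closed downwards in
   the above sense. A back-and-forth argument gives an automorphism h of the tree Z^(<omega), of the form
   h(x)(k) = x(k) + offset(x restricted to k), with h[S] = S and h[D] = E. It can be arranged to change
   only finitely many coordinates of each point of the closed sets covering the rest of the lambda-set,
   so that h[X] = X.

   X^2 is not CDH: let A be the slice x 0 = 0. A countable dense set D can be chosen so that D is G_delta
   off A x A. The meager open complement of A x A is preserved by autohomeomorphisms of X^2, whereas the
   countable dense set Q x Q meets A x {b} in a countable dense subset of that copy of the Baire space,
   which is not G_delta there. *)

theory Submission
  imports Defs
begin

section \<open>Automorphisms of the tree of finite sequences\<close>

definition agree :: "nat \<Rightarrow> (nat \<Rightarrow> 'a) \<Rightarrow> (nat \<Rightarrow> 'a) \<Rightarrow> bool" where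
  "agree n x y \<longleftrightarrow> (\<forall>j<n. x j = y j)"

lemma agree_refl [simp]: "agree n x x"
  and agree_0 [simp]: "agree 0 x y"
  and agree_sym: "agree n x y \<Longrightarrow> agree n y x"
  and agree_trans: "agree n x y \<Longrightarrow> agree n y z \<Longrightarrow> agree n x z"
  and agree_mono: "agree n x y \<Longrightarrow> m \<le> n \<Longrightarrow> agree m x y"
  and agree_Suc: "agree (Suc n) x y \<longleftrightarrow> agree n x y \<and> x n = y n"
  by (auto simp: agree_def less_Suc_eq)

text \<open>A coherent relation is a partial map induced by an automorphism of the tree of finite
  sequences that translates the children of each node: the translation at level k may depend only on
  the first k entries of the source.\<close>

definition coherent :: "((nat \<Rightarrow> 'a::ab_group_add) \<times> (nat \<Rightarrow> 'a)) set \<Rightarrow> bool" where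
  "coherent R \<longleftrightarrow>
     (\<forall>d e d' e' k. (d, e) \<in> R \<and> (d', e') \<in> R \<and> agree k d d' \<longrightarrow> e k - d k = e' k - d' k)"

lemma coherentD:
  "coherent R \<Longrightarrow> (d, e) \<in> R \<Longrightarrow> (d', e') \<in> R \<Longrightarrow> agree k d d' \<Longrightarrow> e k - d k = e' k - d' k"
  unfolding coherent_def by blast

text \<open>Sources that agree up to k receive the same translation at k, so they split at
  coordinate k exactly when their images do. This makes coherence symmetric and turns a back step
  into a forth step for the converse relation.\<close>

lemma coherent_agree_iff:
  assumes "coherent R" "(d, e) \<in> R" "(d', e') \<in> R"
  shows "agree k d d' \<longleftrightarrow> agree k e e'"
proof (induction k)
  case (Suc k)
  show ?case
  proof (cases "agree k d d'")
    case True
    then have "e k - d k = e' k - d' k"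
      using assms coherentD by blast
    then have "d k = d' k \<longleftrightarrow> e k = e' k"
      by (metis add_diff_cancel_left' diff_add_cancel diff_diff_eq2)
    then show ?thesis
      using Suc by (simp add: agree_Suc)
  qed (use Suc in \<open>simp add: agree_Suc\<close>)
qed simp

lemma coherent_converse:
  assumes "coherent R"
  shows "coherent (R\<inverse>)"
  unfolding coherent_def
proof clarsimp
  fix d e d' e' k assume *: "(e, d) \<in> R" "(e', d') \<in> R" "agree k d d'"
  then have "agree k e e'"
    using coherent_agree_iff[OF assms] by blast
  then have "d k - e k = d' k - e' k"
    using * coherentD[OF assms] by blast
  then show "e k - d k = e' k - d' k"
    by (metis minus_diff_eq)
qed

text \<open>For coherent R the chosen pair is irrelevant, and the offset at x and k depends only on the first
  k entries of x.\<close>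

definition offset :: "((nat \<Rightarrow> 'a::ab_group_add) \<times> (nat \<Rightarrow> 'a)) set \<Rightarrow> (nat \<Rightarrow> 'a) \<Rightarrow> nat \<Rightarrow> 'a" where
  "offset R x k =
     (if \<exists>p\<in>R. agree k (fst p) x
      then let p = SOME p. p \<in> R \<and> agree k (fst p) x in snd p k - fst p k
      else 0)"

lemma offset_eq:
  assumes "coherent R" "(d, e) \<in> R" "agree k d x"
  shows "offset R x k = e k - d k"
proof -
  define p where "p = (SOME p. p \<in> R \<and> agree k (fst p) x)"
  have p: "p \<in> R \<and> agree k (fst p) x"
    unfolding p_def by (rule someI[of _ "(d, e)"]) (use assms in auto)
  then have "agree k (fst p) d"
    using assms(3) agree_sym agree_trans by blast
  then have "snd p k - fst p k = e k - d k"
    using coherentD[OF assms(1), of "fst p" "snd p" d e k] p assms(2) by simp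
  then show ?thesis
    unfolding offset_def p_def[symmetric] Let_def using assms by force
qed

lemma offset_nonzeroE:
  assumes "offset R x k \<noteq> 0"
  obtains d e where "(d, e) \<in> R" "agree k d x"
proof -
  have "\<exists>p\<in>R. agree k (fst p) x"
    using assms unfolding offset_def by presburger
  then show ?thesis
    using that by force
qed

lemma offset_cong:
  assumes "agree k x y"
  shows "offset R x k = offset R y k"
proof -
  have "agree k d x \<longleftrightarrow> agree k d y" for d
    using assms by (auto simp: agree_def)
  then show ?thesis
    by (simp add: offset_def)
qed

definition act :: "((nat \<Rightarrow> 'a::ab_group_add) \<times> (nat \<Rightarrow> 'a)) set \<Rightarrow> (nat \<Rightarrow> 'a) \<Rightarrow> nat \<Rightarrow> 'a" where
  "act R x k = x k + offset R x k"

lemma act_pair: "coherent R \<Longrightarrow> (d, e) \<in> R \<Longrightarrow> act R d = e"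
  by (auto simp: act_def fun_eq_iff offset_eq)

lemma agree_act_iff: "agree k (act R x) (act R y) \<longleftrightarrow> agree k x y"
proof (induction k)
  case (Suc k)
  have "agree k x y \<Longrightarrow> act R x k = act R y k \<longleftrightarrow> x k = y k"
    by (simp add: act_def offset_cong)
  then show ?case
    using Suc by (auto simp: agree_Suc)
qed simp

text \<open>Since \<open>act R\<close> preserves the length of agreement, for (d, e) in R the source
  d agrees with x up to k exactly when e agrees with \<open>act R x\<close> up to k. Hence the
  converse relation undoes each translation.\<close>

lemma offset_converse_act:
  assumes "coherent R"
  shows "offset (R\<inverse>) (act R x) k = - offset R x k"
proof (cases "\<exists>(d, e)\<in>R. agree k d x")
  case True
  then obtain d e where de: "(d, e) \<in> R" "agree k d x"
    by auto
  then have "agree k e (act R x)"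
    using act_pair[OF assms] agree_act_iff by metis
  then show ?thesis
    using de assms by (simp add: offset_eq[of _ d e] offset_eq[of _ e d] coherent_converse)
next
  case False
  then have "offset R x k = 0"
    by (auto elim: offset_nonzeroE)
  moreover have "offset (R\<inverse>) (act R x) k = 0"
  proof (rule ccontr)
    assume "offset (R\<inverse>) (act R x) k \<noteq> 0"
    then obtain d e where "(d, e) \<in> R" "agree k e (act R x)"
      by (metis converseD offset_nonzeroE)
    then show False
      using False act_pair[OF assms] agree_act_iff by blast
  qed
  ultimately show ?thesis
    by simp
qed

lemma act_converse_act: "coherent R \<Longrightarrow> act (R\<inverse>) (act R x) = x"
  using offset_converse_act[of R x] by (auto simp: fun_eq_iff act_def)

lemma act_act_converse: "coherent R \<Longrightarrow> act R (act (R\<inverse>) x) = x"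
  using act_converse_act[OF coherent_converse, of R x] by simp

section \<open>Finite modifications and integer sequences\<close>

definition eq_fin :: "(nat \<Rightarrow> 'a) \<Rightarrow> (nat \<Rightarrow> 'a) \<Rightarrow> bool" where
  "eq_fin x y \<longleftrightarrow> finite {k. x k \<noteq> y k}"

lemma eq_fin_refl [simp]: "eq_fin x x"
  by (simp add: eq_fin_def)

lemma eq_fin_sym: "eq_fin x y \<Longrightarrow> eq_fin y x"
  by (simp add: eq_fin_def eq_commute)

lemma eq_fin_trans: "eq_fin x y \<Longrightarrow> eq_fin y z \<Longrightarrow> eq_fin x z"
  unfolding eq_fin_def by (rule finite_subset[of _ "{k. x k \<noteq> y k} \<union> {k. y k \<noteq> z k}"]) auto

lemma eq_fin_act: "finite {k. offset R x k \<noteq> 0} \<Longrightarrow> eq_fin (act R x) x"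
  by (simp add: eq_fin_def act_def)

text \<open>The Baire space Z^omega, realised as a closed subset of the real sequences so that it
  inherits their product topology.\<close>

definition int_seqs :: "(nat \<Rightarrow> real) set" where
  "int_seqs = {x. \<forall>k. x k \<in> \<int>}"

definition prefix_dense :: "(nat \<Rightarrow> real) set \<Rightarrow> bool" where
  "prefix_dense B \<longleftrightarrow> (\<forall>z\<in>int_seqs. \<forall>K. \<exists>e\<in>B. agree K e z)"

lemma act_int_seqs:
  assumes "coherent R" "R \<subseteq> int_seqs \<times> int_seqs" "x \<in> int_seqs"
  shows "act R x \<in> int_seqs"
proof -
  have "offset R x k \<in> \<int>" for k
  proof (cases "offset R x k = 0")
    case False
    then obtain d e where "(d, e) \<in> R" "agree k d x"
      by (rule offset_nonzeroE)
    then show ?thesis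
      using assms by (auto simp: offset_eq int_seqs_def)
  qed simp
  then show ?thesis
    using assms by (simp add: act_def int_seqs_def)
qed

section \<open>Back-and-forth with finite changes on prescribed sets\<close>

definition avoids :: "(nat \<Rightarrow> 'a) set \<Rightarrow> (nat \<Rightarrow> 'a) \<Rightarrow> bool" where
  "avoids F z \<longleftrightarrow> (\<exists>K. \<forall>x\<in>F. \<not> agree K x z)"

text \<open>When the pair (d, e) is added at stage n, offsets are nonzero only at nodes already in use or
  at nodes missed by the first n + 1 closed sets F m. Hence each point of F m meets nonzero offsets
  coming from only finitely many stages.\<close>

definition fresh where
  "fresh F n p d e \<longleftrightarrow>
     (\<forall>k. e k \<noteq> d k \<longrightarrow> (\<exists>(d', e')\<in>p. agree k d' d) \<or>
        (\<forall>m\<le>n. \<forall>x\<in>F m. \<not> agree k x d \<and> \<not> agree k x e))"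

text \<open>Avoidance means that some cylinder around z misses the set. For finitely many sets the
  largest of the lengths serves all of them.\<close>

lemma avoids_le:
  assumes "\<And>m::nat. avoids (F m) z"
  obtains K where "\<And>k m x. K \<le> k \<Longrightarrow> m \<le> n \<Longrightarrow> x \<in> F m \<Longrightarrow> \<not> agree k x z"
proof -
  obtain K where K: "\<And>m x. x \<in> F m \<Longrightarrow> \<not> agree (K m) x z"
    using assms unfolding avoids_def by metis
  have "\<not> agree k x z" if "Max (K ` {..n}) \<le> k" "m \<le> n" "x \<in> F m" for k m x
  proof -
    have "K m \<le> k"
      using that by (meson Max_ge atMost_iff finite_atMost finite_imageI imageI order_trans)
    then show ?thesis
      using K that agree_mono by blast
  qed
  then show ?thesis
    using that by blast
qed

lemma agree_neq_finite:
  assumes "x \<noteq> y"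
  obtains K where "\<And>k. K \<le> k \<Longrightarrow> \<not> agree k x y"
proof -
  obtain j where "x j \<noteq> y j"
    using assms by auto
  then have "\<not> agree k x y" if "Suc j \<le> k" for k
    using that by (auto simp: agree_def Suc_le_eq)
  then show ?thesis
    using that by blast
qed

text \<open>One forth step. The image \<open>act p d\<close> dictated so far differs from d only
  finitely often, because the finitely many sources in p branch off from d. Past that level the
  image is free and can be steered into the dense set B. As d and its provisional image avoid every
  F m, a late enough cut-off puts all new translations at nodes missed by F 0, ..., F n.\<close>

lemma extend_pair:
  fixes F :: "nat \<Rightarrow> (nat \<Rightarrow> real) set"
  assumes coh: "coherent p" and fin: "finite p" and int: "p \<subseteq> int_seqs \<times> int_seqs"
    and fix0: "\<And>d e. (d, e) \<in> p \<Longrightarrow> e 0 = d 0"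
    and col: "\<And>e. (d, e) \<in> p \<Longrightarrow> e \<in> B"
    and d: "d \<in> int_seqs"
    and av: "\<And>z m. eq_fin z d \<Longrightarrow> z 0 = d 0 \<Longrightarrow> avoids (F m) z"
    and dense: "prefix_dense B"
  shows "\<exists>e\<in>B. e 0 = d 0 \<and> coherent (insert (d, e) p) \<and> fresh F n p d e"
proof (cases "d \<in> fst ` p")
  case True
  then obtain e where e: "(d, e) \<in> p"
    by auto
  then have "fresh F n p d e"
    unfolding fresh_def by force
  then show ?thesis
    using e col fix0 coh by (intro bexI[of _ e]) (auto simp: insert_absorb)
next
  case False
  define z where "z = act p d"
  have z0: "z 0 = d 0"
  proof -
    have "offset p d 0 = 0"
      by (metis agree_0 coh diff_self fix0 offset_eq offset_nonzeroE)
    then show ?thesis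
      by (simp add: z_def act_def)
  qed
  have "\<exists>K. \<forall>k\<ge>K. \<not> agree k (fst q) d" if "q \<in> p" for q
  proof -
    have "fst q \<noteq> d"
      using False that by force
    then show ?thesis
      by (meson agree_neq_finite)
  qed
  then obtain L where L: "\<And>q k. q \<in> p \<Longrightarrow> L q \<le> k \<Longrightarrow> \<not> agree k (fst q) d"
    by metis
  obtain K0 where K0: "\<And>q k. q \<in> p \<Longrightarrow> K0 \<le> k \<Longrightarrow> \<not> agree k (fst q) d"
  proof
    fix q k assume "q \<in> p" "Max (L ` p) \<le> k"
    then have "L q \<le> k"
      using fin by (meson Max_ge finite_imageI imageI order_trans)
    then show "\<not> agree k (fst q) d"
      using L \<open>q \<in> p\<close> by blast
  qed
  have "offset p d k = 0" if "K0 \<le> k" for k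
    using K0 that by (metis fst_conv offset_nonzeroE)
  then have "{k. offset p d k \<noteq> 0} \<subseteq> {..<K0}"
    by (auto simp: not_less[symmetric])
  then have zd: "eq_fin z d"
    unfolding z_def by (intro eq_fin_act) (rule finite_subset, auto)
  obtain K1 where K1: "\<And>k m x. K1 \<le> k \<Longrightarrow> m \<le> n \<Longrightarrow> x \<in> F m \<Longrightarrow> \<not> agree k x d"
    using avoids_le[of F d n] av[of d] by auto
  obtain K2 where K2: "\<And>k m x. K2 \<le> k \<Longrightarrow> m \<le> n \<Longrightarrow> x \<in> F m \<Longrightarrow> \<not> agree k x z"
    using avoids_le[of F z n] av[OF zd z0] by auto
  \<comment> \<open>K lies beyond the branching of p from d and beyond the levels at which d and z
    leave the first n + 1 sets. The successor makes K positive, so that e keeps coordinate 0 of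
    z.\<close>
  define K where "K = Suc (K0 + K1 + K2)"
  have "z \<in> int_seqs"
    unfolding z_def by (rule act_int_seqs[OF coh int d])
  then obtain e where e: "e \<in> B" "agree K e z"
    using dense unfolding prefix_dense_def by blast
  have e_eq: "e k = z k" if "k < K" for k
    using e that by (auto simp: agree_def)
  have new: "e k - d k = e' k - d' k" if "(d', e') \<in> p" "agree k d' d" for k d' e'
  proof -
    have "\<not> K0 \<le> k"
      using that K0[of "(d', e')" k] by auto
    then have "k < K"
      by (simp add: K_def)
    then show ?thesis
      unfolding e_eq[OF \<open>k < K\<close>] z_def act_def offset_eq[OF coh that] by simp
  qed
  have "coherent (insert (d, e) p)"
    unfolding coherent_def
  proof (intro allI impI, elim conjE)
    fix d1 e1 d2 e2 k
    assume *: "(d1, e1) \<in> insert (d, e) p" "(d2, e2) \<in> insert (d, e) p" "agree k d1 d2"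
    consider "(d1, e1) = (d, e)" "(d2, e2) = (d, e)" | "(d1, e1) = (d, e)" "(d2, e2) \<in> p"
      | "(d1, e1) \<in> p" "(d2, e2) = (d, e)" | "(d1, e1) \<in> p" "(d2, e2) \<in> p"
      using * by blast
    then show "e1 k - d1 k = e2 k - d2 k"
    proof cases
      case 2
      then show ?thesis
        using new[of d2 e2 k] agree_sym[OF *(3)] by simp
    next
      case 3
      then show ?thesis
        using new[of d1 e1 k] *(3) by simp
    next
      case 4
      then show ?thesis
        using *(3) coherentD[OF coh] by blast
    qed simp
  qed
  moreover have "fresh F n p d e"
    unfolding fresh_def
  proof (intro allI impI)
    fix k assume k: "e k \<noteq> d k"
    show "(\<exists>(d', e')\<in>p. agree k d' d) \<or> (\<forall>m\<le>n. \<forall>x\<in>F m. \<not> agree k x d \<and> \<not> agree k x e)"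
    proof (cases "k < K")
      case True
      then have "offset p d k \<noteq> 0"
        using k e_eq[of k] by (simp add: z_def act_def)
      then obtain d' e' where "(d', e') \<in> p" "agree k d' d"
        by (rule offset_nonzeroE)
      then show ?thesis
        by blast
    next
      case False
      have "\<not> agree k x e" if "m \<le> n" "x \<in> F m" for m x
      proof
        assume "agree k x e"
        then have "agree K x z"
          using False e(2) by (meson agree_mono agree_trans not_less)
        then show False
          using K2[of K m x] that by (simp add: K_def)
      qed
      then show ?thesis
        using K1 False by (auto simp: K_def)
    qed
  qed
  moreover have "e 0 = d 0"
    using e_eq[of 0] z0 by (simp add: K_def)
  ultimately show ?thesis
    using e by blast
qed

text \<open>Even stages put the next point of S into the domain, odd stages into the range, with D
  matched to E and S - D to S - E. Freshness at every stage yields the two finiteness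
  claims.\<close>

lemma back_and_forth:
  fixes D E S :: "(nat \<Rightarrow> real) set" and F :: "nat \<Rightarrow> (nat \<Rightarrow> real) set"
  assumes S: "countable S" "S \<subseteq> int_seqs"
    and D: "D \<subseteq> S" "prefix_dense D" "prefix_dense (S - D)"
    and E: "E \<subseteq> S" "prefix_dense E" "prefix_dense (S - E)"
    and av: "\<And>d z m. d \<in> S \<Longrightarrow> eq_fin z d \<Longrightarrow> z 0 = d 0 \<Longrightarrow> avoids (F m) z"
  obtains R where "coherent R" "R \<subseteq> S \<times> S" "fst ` R = S" "snd ` R = S"
    "\<And>d e. (d, e) \<in> R \<Longrightarrow> d \<in> D \<longleftrightarrow> e \<in> E"
    "\<And>d e. (d, e) \<in> R \<Longrightarrow> e 0 = d 0"
    "\<And>m x. x \<in> F m \<Longrightarrow> finite {k. offset R x k \<noteq> 0}"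
    "\<And>m x. x \<in> F m \<Longrightarrow> finite {k. offset (R\<inverse>) x k \<noteq> 0}"
proof -
  have "(\<lambda>_. 0) \<in> int_seqs"
    by (simp add: int_seqs_def)
  then have "S \<noteq> {}"
    using D unfolding prefix_dense_def by blast
  then obtain a :: "nat \<Rightarrow> nat \<Rightarrow> real" where a: "range a = S"
    using S(1) by (metis range_from_nat_into)
  \<comment> \<open>The condition sees f only through its values below n, as the well-founded choice
    of f requires.\<close>
  define P where "P f n r \<longleftrightarrow>
      (case r of (d, e) \<Rightarrow> d \<in> S \<and> e \<in> S \<and> (d \<in> D \<longleftrightarrow> e \<in> E) \<and> e 0 = d 0 \<and>
        coherent (insert (d, e) (f ` {..<n})) \<and> fresh F n (f ` {..<n}) d e \<and>
        (if even n then d else e) = a (n div 2))"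
    for f :: "nat \<Rightarrow> (nat \<Rightarrow> real) \<times> (nat \<Rightarrow> real)" and n :: nat and r
  have ex: "\<exists>r. P f n r" if prev: "\<And>i. i < n \<Longrightarrow> P f i (f i)" for f n
  proof -
    define p where "p = f ` {..<n}"
    have fin: "finite p" "finite (p\<inverse>)"
      by (auto simp: p_def)
    have p: "d \<in> S \<and> e \<in> S \<and> (d \<in> D \<longleftrightarrow> e \<in> E) \<and> e 0 = d 0" if "(d, e) \<in> p" for d e
    proof -
      obtain i where "i < n" "f i = (d, e)"
        using \<open>(d, e) \<in> p\<close> unfolding p_def by (metis imageE lessThan_iff)
      then show ?thesis
        using prev[of i] by (simp add: P_def)
    qed
    have coh: "coherent p"
      unfolding coherent_def
    proof (intro allI impI, elim conjE)
      fix d e d' e' k assume *: "(d, e) \<in> p" "(d', e') \<in> p" "agree k d d'"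
      then obtain i j where ij: "i < n" "j < n" "f i = (d, e)" "f j = (d', e')"
        unfolding p_def by (metis imageE lessThan_iff)
      define l where "l = max i j"
      have "l < n"
        using ij by (simp add: l_def)
      then have "coherent (insert (f l) (f ` {..<l}))"
        using prev[of l] by (auto simp: P_def split: prod.splits)
      moreover have "insert (f l) (f ` {..<l}) = f ` {..l}"
        by (auto simp: le_less)
      moreover have "f i \<in> f ` {..l}" "f j \<in> f ` {..l}"
        by (auto simp: l_def)
      ultimately show "e k - d k = e' k - d' k"
        using ij * coherentD by metis
    qed
    have int: "p \<subseteq> int_seqs \<times> int_seqs" "p\<inverse> \<subseteq> int_seqs \<times> int_seqs"
      using p S by auto
    define b where "b = a (n div 2)"
    have b: "b \<in> S"
      using a by (auto simp: b_def)
    show ?thesis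
    proof (cases "even n")
      case True
      define B where "B = (if b \<in> D then E else S - E)"
      have "\<exists>e\<in>B. e 0 = b 0 \<and> coherent (insert (b, e) p) \<and> fresh F n p b e"
      proof (rule extend_pair[OF coh fin(1) int(1)])
        show "prefix_dense B"
          using E by (simp add: B_def)
        show "b \<in> int_seqs"
          using b S by blast
      qed (use p b av in \<open>auto simp: B_def\<close>)
      then obtain e where e: "e \<in> B" "e 0 = b 0" "coherent (insert (b, e) p)" "fresh F n p b e"
        by blast
      then have "P f n (b, e)"
        using True b E D by (auto simp: P_def p_def b_def B_def split: if_splits)
      then show ?thesis ..
    next
      case False
      define B where "B = (if b \<in> E then D else S - D)"
      have "\<exists>d\<in>B. d 0 = b 0 \<and> coherent (insert (b, d) (p\<inverse>)) \<and> fresh F n (p\<inverse>) b d"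
      proof (rule extend_pair[OF coherent_converse[OF coh] fin(2) int(2)])
        show "prefix_dense B"
          using D by (simp add: B_def)
        show "b \<in> int_seqs"
          using b S by blast
        show "e 0 = d 0" if "(d, e) \<in> p\<inverse>" for d e
          using p[of e d] that by simp
      qed (use p b av in \<open>auto simp: B_def\<close>)
      then obtain d where d: "d \<in> B" "d 0 = b 0" "coherent (insert (b, d) (p\<inverse>))" "fresh F n (p\<inverse>) b d"
        by blast
      have "insert (b, d) (p\<inverse>) = (insert (d, b) p)\<inverse>"
        by auto
      then have coh': "coherent (insert (d, b) p)"
        using d(3) coherent_converse converse_converse by metis
      \<comment> \<open>The odd stage gives freshness for the converse relation. By coherence of the
        enlarged relation, sharing a node on the target side implies sharing it on the source
        side.\<close>
      have "fresh F n p d b"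
        unfolding fresh_def
      proof (intro allI impI)
        fix k assume "b k \<noteq> d k"
        then have "(\<exists>(d', e')\<in>p\<inverse>. agree k d' b) \<or> (\<forall>m\<le>n. \<forall>x\<in>F m. \<not> agree k x b \<and> \<not> agree k x d)"
          using d(4) unfolding fresh_def by metis
        moreover have "agree k d' d" if "(d', e') \<in> p" "agree k e' b" for d' e'
          using coherent_agree_iff[OF coh', of d' e' d b k] that by blast
        ultimately show "(\<exists>(d', e')\<in>p. agree k d' d) \<or> (\<forall>m\<le>n. \<forall>x\<in>F m. \<not> agree k x d \<and> \<not> agree k x b)"
          by blast
      qed
      then have "P f n (d, b)"
        using False b d coh' E D by (auto simp: P_def p_def b_def B_def split: if_splits)
      then show ?thesis ..
    qed
  qed
  have "\<exists>f. \<forall>n. P f n (f n)"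
  proof (rule dependent_wf_choice[OF wf_less_than])
    fix f g :: "nat \<Rightarrow> (nat \<Rightarrow> real) \<times> (nat \<Rightarrow> real)" and n r
    assume "\<And>i. (i, n) \<in> less_than \<Longrightarrow> f i = g i"
    then have "f ` {..<n} = g ` {..<n}"
      by (intro image_cong) auto
    then show "P f n r = P g n r"
      by (simp add: P_def)
  qed (use ex in auto)
  then obtain f where f: "\<And>n. P f n (f n)"
    by blast
  define R where "R = range f"
  have R: "d \<in> S \<and> e \<in> S \<and> (d \<in> D \<longleftrightarrow> e \<in> E) \<and> e 0 = d 0" if "(d, e) \<in> R" for d e
  proof -
    obtain n where "f n = (d, e)"
      using \<open>(d, e) \<in> R\<close> unfolding R_def by (metis imageE)
    then show ?thesis
      using f[of n] by (simp add: P_def)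
  qed
  have coh: "coherent R"
    unfolding coherent_def
  proof (intro allI impI, elim conjE)
    fix d e d' e' k assume *: "(d, e) \<in> R" "(d', e') \<in> R" "agree k d d'"
    then obtain i j where ij: "f i = (d, e)" "f j = (d', e')"
      unfolding R_def by (metis imageE)
    define l where "l = max i j"
    have "coherent (insert (f l) (f ` {..<l}))"
      using f[of l] by (auto simp: P_def split: prod.splits)
    moreover have "insert (f l) (f ` {..<l}) = f ` {..l}"
      by (auto simp: le_less)
    moreover have "f i \<in> f ` {..l}" "f j \<in> f ` {..l}"
      by (auto simp: l_def)
    ultimately show "e k - d k = e' k - d' k"
      using ij * coherentD by metis
  qed
  \<comment> \<open>If x meets a translation at level k, on either side, take the first stage n
    causing it. An earlier pair through the same node would carry the same translation, against
    minimality. So freshness leaves only n < m.\<close>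
  have small: "n < m \<and> (agree k x (fst (f n)) \<or> agree k x (snd (f n)))"
    if "(\<exists>n. snd (f n) k \<noteq> fst (f n) k \<and> (agree k x (fst (f n)) \<or> agree k x (snd (f n))))" "x \<in> F m"
      and n_def: "n = (LEAST n. snd (f n) k \<noteq> fst (f n) k \<and> (agree k x (fst (f n)) \<or> agree k x (snd (f n))))"
    for x m k n
  proof -
    have n: "snd (f n) k \<noteq> fst (f n) k \<and> (agree k x (fst (f n)) \<or> agree k x (snd (f n)))"
      unfolding n_def using that(1) by (rule LeastI_ex)
    have least: "\<not> (snd (f i) k \<noteq> fst (f i) k \<and> (agree k x (fst (f i)) \<or> agree k x (snd (f i))))"
      if "i < n" for i
      using not_less_Least that unfolding n_def by blast
    have *: "\<not> agree k (fst (f i)) (fst (f n))" if "i < n" for i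
    proof
      assume ag: "agree k (fst (f i)) (fst (f n))"
      have mem: "(fst (f i), snd (f i)) \<in> R" "(fst (f n), snd (f n)) \<in> R"
        by (auto simp: R_def)
      then have "snd (f i) k - fst (f i) k = snd (f n) k - fst (f n) k"
        using coherentD[OF coh] ag by blast
      moreover have "agree k (snd (f i)) (snd (f n))"
        using ag coherent_agree_iff[OF coh mem] by blast
      ultimately show False
        using least[OF that] n ag agree_sym agree_trans by (metis eq_iff_diff_eq_0)
    qed
    have "fresh F n (f ` {..<n}) (fst (f n)) (snd (f n))"
      using f[of n] by (auto simp: P_def split: prod.splits)
    then have "(\<exists>(d', e')\<in>f ` {..<n}. agree k d' (fst (f n))) \<or>
        (\<forall>m\<le>n. \<forall>x\<in>F m. \<not> agree k x (fst (f n)) \<and> \<not> agree k x (snd (f n)))"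
      using n unfolding fresh_def by blast
    then show ?thesis
    proof
      assume "\<exists>(d', e')\<in>f ` {..<n}. agree k d' (fst (f n))"
      then obtain i where "i < n" "agree k (fst (f i)) (fst (f n))"
        by (auto simp: case_prod_beta)
      then show ?thesis
        using * by blast
    next
      assume "\<forall>m\<le>n. \<forall>x\<in>F m. \<not> agree k x (fst (f n)) \<and> \<not> agree k x (snd (f n))"
      then have "\<not> m \<le> n"
        using n that(2) by blast
      then show ?thesis
        using n by simp
    qed
  qed
  \<comment> \<open>Only pairs from the first m stages matter; their entries lie in S and thus avoid
    F m, so each agrees with x up to only finitely many levels.\<close>
  have bound: "finite {k. \<exists>n. snd (f n) k \<noteq> fst (f n) k \<and> (agree k x (fst (f n)) \<or> agree k x (snd (f n)))}"
    if "x \<in> F m" for x m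
  proof -
    have "finite {k. agree k x y}" if "y \<in> S" for y
    proof -
      obtain K where "\<not> agree K x y"
        using av[of y y m] \<open>y \<in> S\<close> \<open>x \<in> F m\<close> by (auto simp: avoids_def)
      then have "{k. agree k x y} \<subseteq> {..<K}"
        using agree_mono not_less by blast
      then show ?thesis
        using finite_subset by blast
    qed
    moreover have "fst (f n) \<in> S" "snd (f n) \<in> S" for n
      using f[of n] by (auto simp: P_def split: prod.splits)
    ultimately have "finite (\<Union>n<m. {k. agree k x (fst (f n))} \<union> {k. agree k x (snd (f n))})"
      by blast
    then show ?thesis
      by (rule rev_finite_subset) (use small that in blast)
  qed
  show ?thesis
  proof
    show "coherent R" "R \<subseteq> S \<times> S"
      using coh R by auto
    have "b \<in> fst ` R \<and> b \<in> snd ` R" if "b \<in> S" for b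
    proof -
      obtain i where i: "b = a i"
        using a \<open>b \<in> S\<close> by (metis imageE)
      have "fst (f (2 * i)) = b" "snd (f (2 * i + 1)) = b"
        using f[of "2 * i"] f[of "2 * i + 1"] i by (auto simp: P_def split: prod.splits)
      then show ?thesis
        unfolding R_def by (metis imageI rangeI)
    qed
    then show "fst ` R = S" "snd ` R = S"
      using R by force+
    fix m x assume x: "x \<in> F m"
    show "finite {k. offset R x k \<noteq> 0}"
    proof (rule finite_subset[OF _ bound[OF x]], safe)
      fix k assume nz: "offset R x k \<noteq> 0"
      then obtain d e where de: "(d, e) \<in> R" "agree k d x"
        by (rule offset_nonzeroE)
      then have "e k \<noteq> d k"
        using nz offset_eq[OF coh de] by simp
      moreover obtain n where "f n = (d, e)"
        using de unfolding R_def by (metis converseD imageE)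
      ultimately show "\<exists>n. snd (f n) k \<noteq> fst (f n) k \<and> (agree k x (fst (f n)) \<or> agree k x (snd (f n)))"
        using agree_sym[OF de(2)] by (intro exI[of _ n]) simp
    qed
    show "finite {k. offset (R\<inverse>) x k \<noteq> 0}"
    proof (rule finite_subset[OF _ bound[OF x]], safe)
      fix k assume nz: "offset (R\<inverse>) x k \<noteq> 0"
      then obtain e d where de: "(e, d) \<in> R\<inverse>" "agree k e x"
        by (rule offset_nonzeroE)
      then have "e k \<noteq> d k"
        using nz offset_eq[OF coherent_converse[OF coh] de] by simp
      moreover obtain n where "f n = (d, e)"
        using de unfolding R_def by (metis converseD imageE)
      ultimately show "\<exists>n. snd (f n) k \<noteq> fst (f n) k \<and> (agree k x (fst (f n)) \<or> agree k x (snd (f n)))"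
        using agree_sym[OF de(2)] by (intro exI[of _ n]) simp
    qed
  qed (use R in auto)
qed

section \<open>A chain of type omega_1 under eventual dominance\<close>

definition eventually_le :: "(nat \<Rightarrow> real) \<Rightarrow> (nat \<Rightarrow> real) \<Rightarrow> bool" where
  "eventually_le x y \<longleftrightarrow> (\<forall>\<^sub>F k in sequentially. x k \<le> y k)"

text \<open>Diagonalisation: at coordinate k the bound exceeds the values of the first k + 1 members
  of an enumeration.\<close>

lemma countable_strict_bound:
  fixes H :: "(nat \<Rightarrow> real) set"
  assumes "countable H"
  shows "\<exists>g\<in>int_seqs. \<forall>x\<in>H. \<forall>\<^sub>F k in sequentially. x k < g k"
proof (cases "H = {}")
  case True
  then show ?thesis
    by (auto intro!: exI[of _ "\<lambda>_. 0"] simp: int_seqs_def)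
next
  case False
  then obtain a :: "nat \<Rightarrow> nat \<Rightarrow> real" where a: "range a = H"
    using assms by (metis range_from_nat_into)
  define g :: "nat \<Rightarrow> real" where "g k = of_int (\<lfloor>Max ((\<lambda>i. a i k) ` {..k})\<rfloor> + 1)" for k
  have "a i k < g k" if "i \<le> k" for i k
  proof -
    have "a i k \<le> Max ((\<lambda>i. a i k) ` {..k})"
      using that by (intro Max_ge) auto
    also have "\<dots> < g k"
      unfolding g_def by linarith
    finally show ?thesis .
  qed
  then have "\<forall>\<^sub>F k in sequentially. a i k < g k" for i
    using eventually_sequentially by blast
  then show ?thesis
    using a by (intro bexI[of _ g]) (auto simp: int_seqs_def g_def)
qed

text \<open>Recursion along a well-order of the reals, each value dominating all earlier ones. A
  countable H comes from points below some w, and the value at w is the witness g: it strictly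
  dominates H, and only values at predecessors of w can fail to lie eventually above it.\<close>

lemma exists_omega1_chain:
  obtains C :: "(nat \<Rightarrow> real) set" where "C \<subseteq> int_seqs" "uncountable C"
    "\<And>H. countable H \<Longrightarrow> H \<subseteq> C \<Longrightarrow>
       \<exists>g. (\<forall>x\<in>H. \<not> eventually_le g x) \<and> countable {x \<in> C. \<not> eventually_le g x}"
proof -
  obtain r :: "real rel" where r: "well_order_on UNIV r"
    using well_order_on by blast
  define q where "q = r - Id"
  have wf: "wf q"
    using r by (simp add: q_def well_order_on_def)
  have tot: "u = v \<or> (u, v) \<in> q \<or> (v, u) \<in> q" for u v
    using r by (auto simp: q_def well_order_on_def linear_order_on_def total_on_def)
  \<comment> \<open>At points with uncountably many predecessors the condition is vacuous, so the
    recursion runs over all reals.\<close>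
  define P where "P f x g \<longleftrightarrow> (countable {y. (y, x) \<in> q} \<longrightarrow>
      g \<in> int_seqs \<and> (\<forall>y. (y, x) \<in> q \<longrightarrow> (\<forall>\<^sub>F k in sequentially. f y k < g k)))"
    for f :: "real \<Rightarrow> nat \<Rightarrow> real" and x g
  have "\<exists>f. \<forall>x. P f x (f x)"
  proof (rule dependent_wf_choice[OF wf])
    fix f :: "real \<Rightarrow> nat \<Rightarrow> real" and x
    show "\<exists>g. P f x g"
    proof (cases "countable {y. (y, x) \<in> q}")
      case True
      then have "countable (f ` {y. (y, x) \<in> q})"
        by simp
      from countable_strict_bound[OF this] obtain g where "g \<in> int_seqs"
          "\<forall>h\<in>f ` {y. (y, x) \<in> q}. \<forall>\<^sub>F k in sequentially. h k < g k"
        by blast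
      then have "P f x g"
        by (simp add: P_def)
      then show ?thesis
        by (rule exI[of _ g])
    qed (simp add: P_def)
  qed (simp add: P_def)
  then obtain f where f: "\<And>x. P f x (f x)"
    by blast
  \<comment> \<open>a copy of omega_1: the longest initial segment all of whose points have countably many predecessors\<close>
  define W where "W = {x. countable {y. (y, x) \<in> q}}"
  have W_int: "f x \<in> int_seqs" if "x \<in> W" for x
    using f[of x] that by (simp add: W_def P_def)
  have less: "\<forall>\<^sub>F k in sequentially. f y k < f x k" if "x \<in> W" "(y, x) \<in> q" for x y
    using f[of x] that by (simp add: W_def P_def)
  have W_unc: "uncountable W"
  proof
    assume cW: "countable W"
    then have "W \<noteq> UNIV"
      using uncountable_UNIV_real by auto
    \<comment> \<open>The least point outside a countable W would have only countably many
      predecessors and so belong to W.\<close>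
    then obtain x where "x \<notin> W" "\<And>y. (y, x) \<in> q \<Longrightarrow> y \<in> W"
      using wfE_min[OF wf, of _ "- W"] by (metis ComplI Compl_iff UNIV_eq_I)
    then have "countable {y. (y, x) \<in> q}"
      by (intro countable_subset[OF _ cW]) auto
    then show False
      using \<open>x \<notin> W\<close> by (simp add: W_def)
  qed
  have "inj_on f W"
  proof (rule inj_onI, rule ccontr)
    fix x y assume *: "x \<in> W" "y \<in> W" "f x = f y" "x \<noteq> y"
    then have "\<forall>\<^sub>F k in sequentially. f x k < f x k"
      using tot[of x y] less by metis
    then show False
      by simp
  qed
  then have unc: "uncountable (f ` W)"
    using W_unc countable_image_inj_on by blast
  show ?thesis
  proof
    show "f ` W \<subseteq> int_seqs"
      using W_int by blast
    fix H assume "countable H" "H \<subseteq> f ` W"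
    then obtain V where V: "countable V" "V \<subseteq> W" "H = f ` V"
      by (metis countable_subset_image)
    \<comment> \<open>V together with all predecessors of its members does not exhaust W; any
      remaining w lies above all of V.\<close>
    have "countable (V \<union> (\<Union>v\<in>V. {y. (y, v) \<in> q}))"
      using V by (auto simp: W_def)
    then have "\<not> W \<subseteq> V \<union> (\<Union>v\<in>V. {y. (y, v) \<in> q})"
      using W_unc countable_subset by blast
    then obtain w where w: "w \<in> W" "w \<notin> V" "\<And>v. v \<in> V \<Longrightarrow> (w, v) \<notin> q"
      by blast
    have "\<not> eventually_le (f w) (f v)" if "v \<in> V" for v
    proof
      assume "eventually_le (f w) (f v)"
      moreover have "(v, w) \<in> q"
        using w that tot by metis
      then have "\<forall>\<^sub>F k in sequentially. f v k < f w k"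
        using less[OF w(1)] by blast
      ultimately have "\<forall>\<^sub>F k in sequentially. False"
        unfolding eventually_le_def by eventually_elim simp
      then show False
        by simp
    qed
    moreover have "{x \<in> f ` W. \<not> eventually_le (f w) x} \<subseteq> f ` {y. (y, w) \<in> q}"
    proof safe
      fix v assume v: "v \<in> W" "\<not> eventually_le (f w) (f v)"
      have "(w, v) \<notin> q"
      proof
        assume "(w, v) \<in> q"
        then have "\<forall>\<^sub>F k in sequentially. f w k < f v k"
          using v(1) less by blast
        then have "eventually_le (f w) (f v)"
          unfolding eventually_le_def by eventually_elim simp
        then show False
          using v(2) by blast
      qed
      moreover have "v \<noteq> w"
        using v by (auto simp: eventually_le_def)
      ultimately show "f v \<in> f ` {y. (y, w) \<in> q}"
        using tot by blast
    qed
    then have "countable {x \<in> f ` W. \<not> eventually_le (f w) x}"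
      by (rule countable_subset) (use w(1) in \<open>simp add: W_def\<close>)
    ultimately show "\<exists>g. (\<forall>x\<in>H. \<not> eventually_le g x) \<and> countable {x \<in> f ` W. \<not> eventually_le g x}"
      using V by blast
  qed (rule unc)
qed

section \<open>Subspaces of the space of integer sequences\<close>

text \<open>A basic product-open set restricts finitely many coordinates, hence contains a cylinder
  around each of its points. Conversely cylinders are open because distinct integers are at distance
  at least 1.\<close>

lemma openin_int_seqs:
  assumes "S \<subseteq> int_seqs"
  shows "openin (top_of_set S) U \<longleftrightarrow>
    U \<subseteq> S \<and> (\<forall>x\<in>U. \<exists>K. \<forall>y\<in>S. agree K y x \<longrightarrow> y \<in> U)"
proof (intro iffI conjI ballI; (elim conjE)?)
  assume U: "openin (top_of_set S) U"
  then show "U \<subseteq> S"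
    using openin_imp_subset by blast
  fix x assume x: "x \<in> U"
  obtain T where T: "open T" "U = S \<inter> T"
    using U by (auto simp: openin_open)
  then have "openin (product_topology (\<lambda>_::nat. euclidean) UNIV) T" "x \<in> T"
    using x by (auto simp: euclidean_product_topology)
  then obtain V where V: "x \<in> (\<Pi>\<^sub>E i\<in>UNIV. V i)" "finite {i. V i \<noteq> (UNIV :: real set)}"
      "(\<Pi>\<^sub>E i\<in>UNIV. V i) \<subseteq> T"
    using product_topology_open_contains_basis[of "\<lambda>_. euclidean" UNIV T x] by auto
  obtain K where K: "\<And>i. V i \<noteq> UNIV \<Longrightarrow> i < K"
    using finite_nat_bounded[OF V(2)] by blast
  have "y \<in> T" if "agree K y x" for y
  proof -
    have "y i \<in> V i" for i
    proof (cases "i < K")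
      case True
      then show ?thesis
        using V(1) \<open>agree K y x\<close> by (auto simp: agree_def PiE_UNIV_domain Pi_iff)
    next
      case False
      then show ?thesis
        using K by blast
    qed
    then show ?thesis
      using V(3) by (auto simp: PiE_UNIV_domain)
  qed
  then show "\<exists>K. \<forall>y\<in>S. agree K y x \<longrightarrow> y \<in> U"
    using T by blast
next
  assume "U \<subseteq> S" and U: "\<forall>x\<in>U. \<exists>K. \<forall>y\<in>S. agree K y x \<longrightarrow> y \<in> U"
  show "openin (top_of_set S) U"
  proof (subst openin_subopen, intro ballI)
    fix x assume x: "x \<in> U"
    then obtain K where K: "\<forall>y\<in>S. agree K y x \<longrightarrow> y \<in> U"
      using U by blast
    define T where "T = (\<Inter>j<K. {y :: nat \<Rightarrow> real. \<bar>y j - x j\<bar> < 1})"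
    have "open T"
      unfolding T_def
      by (intro open_INT ballI open_Collect_less continuous_intros continuous_on_product_coordinates) auto
    moreover have "S \<inter> T \<subseteq> U"
    proof
      fix y assume y: "y \<in> S \<inter> T"
      have "y j = x j" if "j < K" for j
      proof -
        have "y j \<in> \<int>" "x j \<in> \<int>"
          using assms y x \<open>U \<subseteq> S\<close> by (auto simp: int_seqs_def)
        moreover have "\<bar>y j - x j\<bar> < 1"
          using y that by (auto simp: T_def)
        ultimately show ?thesis
          by (meson Ints_eq_abs_less1)
      qed
      then show "y \<in> U"
        using K y by (auto simp: agree_def)
    qed
    moreover have "x \<in> S \<inter> T"
      using x \<open>U \<subseteq> S\<close> by (auto simp: T_def)
    ultimately show "\<exists>W. openin (top_of_set S) W \<and> x \<in> W \<and> W \<subseteq> U"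
      by (intro exI[of _ "S \<inter> T"]) (auto simp: openin_open)
  qed
qed

lemma closedin_int_seqs:
  assumes "S \<subseteq> int_seqs"
  shows "closedin (top_of_set S) U \<longleftrightarrow>
    U \<subseteq> S \<and> (\<forall>x\<in>S - U. \<exists>K. \<forall>y\<in>S. agree K y x \<longrightarrow> y \<notin> U)"
  unfolding closedin_def openin_int_seqs[OF assms] by auto

lemma openin_cylinder:
  assumes "S \<subseteq> int_seqs"
  shows "openin (top_of_set S) {y \<in> S. agree K y x}"
  unfolding openin_int_seqs[OF assms] by (auto intro!: exI[of _ K] elim: agree_trans)

lemma closedin_cylinder:
  assumes "S \<subseteq> int_seqs"
  shows "closedin (top_of_set S) {y \<in> S. agree K y x}"
  unfolding closedin_int_seqs[OF assms] by (auto intro!: exI[of _ K] dest: agree_sym agree_trans)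

lemma openin_prod_int_seqs:
  assumes S: "S \<subseteq> int_seqs" and U: "openin (prod_topology (top_of_set S) (top_of_set S)) U" "(x, y) \<in> U"
  obtains K where "\<And>x' y'. x' \<in> S \<Longrightarrow> y' \<in> S \<Longrightarrow> agree K x' x \<Longrightarrow> agree K y' y \<Longrightarrow> (x', y') \<in> U"
proof -
  obtain V W where VW: "openin (top_of_set S) V" "openin (top_of_set S) W" "x \<in> V" "y \<in> W" "V \<times> W \<subseteq> U"
    using U(1)[unfolded openin_prod_topology_alt, rule_format, OF U(2)] by blast
  obtain K where K: "\<forall>x'\<in>S. agree K x' x \<longrightarrow> x' \<in> V"
    using VW(1,3) unfolding openin_int_seqs[OF S] by blast
  obtain L where L: "\<forall>y'\<in>S. agree L y' y \<longrightarrow> y' \<in> W"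
    using VW(2,4) unfolding openin_int_seqs[OF S] by blast
  show ?thesis
  proof (rule that)
    fix x' y' assume *: "x' \<in> S" "y' \<in> S" "agree (K + L) x' x" "agree (K + L) y' y"
    have "agree K x' x" "agree L y' y"
      using agree_mono[OF *(3), of K] agree_mono[OF *(4), of L] by auto
    then show "(x', y') \<in> U"
      using K L VW(5) *(1,2) by blast
  qed
qed

lemma zero_dimensional_int_seqs:
  assumes S: "S \<subseteq> int_seqs"
  shows "zero_dimensional (top_of_set S)"
  unfolding zero_dimensional_def
proof (intro exI[of _ "{{y \<in> S. agree K y x} | K x. True}"] conjI ballI allI impI)
  fix U x assume "openin (top_of_set S) U \<and> x \<in> U"
  then obtain K where "\<forall>y\<in>S. agree K y x \<longrightarrow> y \<in> U" and "x \<in> S"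
    using openin_int_seqs[OF S] by blast
  then show "\<exists>V\<in>{{y \<in> S. agree K y x} | K x. True}. x \<in> V \<and> V \<subseteq> U"
    by (intro bexI[of _ "{y \<in> S. agree K y x}"]) auto
qed (use openin_cylinder[OF S] closedin_cylinder[OF S] in auto)

lemma continuous_map_agree:
  assumes S: "S \<subseteq> int_seqs" and "f \<in> S \<rightarrow> S" and ag: "\<And>K x y. agree K x y \<Longrightarrow> agree K (f x) (f y)"
  shows "continuous_map (top_of_set S) (top_of_set S) f"
  unfolding continuous_map_def
proof (intro conjI allI impI)
  fix U assume U: "openin (top_of_set S) U"
  have "\<exists>K. \<forall>y\<in>S. agree K y x \<longrightarrow> f y \<in> U" if "x \<in> S" "f x \<in> U" for x
  proof -
    obtain K where "\<forall>y\<in>S. agree K y (f x) \<longrightarrow> y \<in> U"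
      using U \<open>f x \<in> U\<close> unfolding openin_int_seqs[OF S] by blast
    then have "\<forall>y\<in>S. agree K y x \<longrightarrow> f y \<in> U"
      using ag assms(2) by blast
    then show ?thesis ..
  qed
  then show "openin (top_of_set S) {x \<in> topspace (top_of_set S). f x \<in> U}"
    unfolding openin_int_seqs[OF S] by auto
qed (use assms(2) in auto)

lemma closed_int_seqs: "closed int_seqs"
proof -
  have "closed {x :: nat \<Rightarrow> real. x k \<in> \<int>}" for k
    using closed_vimage[OF closed_Ints, of "\<lambda>x::nat \<Rightarrow> real. x k"]
    by (simp add: vimage_def continuous_on_product_coordinates)
  then have "closed (\<Inter>k. {x :: nat \<Rightarrow> real. x k \<in> \<int>})"
    by (intro closed_INT) auto
  moreover have "int_seqs = (\<Inter>k. {x. x k \<in> \<int>})"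
    by (auto simp: int_seqs_def)
  ultimately show ?thesis
    by simp
qed

text \<open>Closedness in the space of real sequences gives complete metrizability, on which both
  Baire category arguments for the square rest.\<close>

lemma completely_metrizable_slice: "completely_metrizable_space (top_of_set {x \<in> int_seqs. x 0 = 0})"
proof -
  have "closedin (top_of_set int_seqs) {x \<in> int_seqs. x 0 = 0}"
    using closedin_cylinder[of int_seqs 1 "\<lambda>_. 0"] by (simp add: agree_def)
  then have "closed {x \<in> int_seqs. x 0 = 0}"
    using closed_int_seqs closedin_closed_trans by blast
  then show ?thesis
    by (intro completely_metrizable_space_closedin completely_metrizable_space_euclidean)
      (simp add: closed_closedin[symmetric])
qed

section \<open>Density and classes modulo finite sets\<close>

lemma prefix_dense_mono: "prefix_dense A \<Longrightarrow> A \<subseteq> B \<Longrightarrow> prefix_dense B"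
  unfolding prefix_dense_def by blast

lemma prefix_dense_if_dense:
  assumes S: "S \<subseteq> int_seqs" "prefix_dense S" and B: "top_of_set S closure_of B = topspace (top_of_set S)"
  shows "prefix_dense B"
  unfolding prefix_dense_def
proof (intro ballI allI)
  fix z :: "nat \<Rightarrow> real" and K assume "z \<in> int_seqs"
  then obtain y where "y \<in> S" "agree K y z"
    using S unfolding prefix_dense_def by blast
  then have "{y \<in> S. agree K y z} \<noteq> {}"
    by blast
  then have "B \<inter> {y \<in> S. agree K y z} \<noteq> {}"
    using B openin_cylinder[OF S(1)] unfolding dense_intersects_open by blast
  then show "\<exists>e\<in>B. agree K e z"
    by blast
qed

text \<open>A finite modification of f is coded by the finite list of integers that replaces an
  initial segment.\<close>

lemma countable_eq_fin_class: "countable {x \<in> int_seqs. eq_fin x f}"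
proof -
  have "{x \<in> int_seqs. eq_fin x f} \<subseteq> range (\<lambda>l k. if k < length l then of_int (l ! k) else f k)"
  proof safe
    fix x assume x: "x \<in> int_seqs" "eq_fin x f"
    obtain K where K: "{k. x k \<noteq> f k} \<subseteq> {..<K}"
      using x(2) finite_nat_bounded unfolding eq_fin_def by blast
    have "x = (\<lambda>k. if k < length (map (\<lambda>k. \<lfloor>x k\<rfloor>) [0..<K]) then of_int (map (\<lambda>k. \<lfloor>x k\<rfloor>) [0..<K] ! k) else f k)"
      using K x(1) by (auto simp: int_seqs_def fun_eq_iff)
    then show "x \<in> range (\<lambda>l k. if k < length l then of_int (l ! k) else f k)"
      by blast
  qed
  then show ?thesis
    by (rule countable_subset) simp
qed

lemma prefix_dense_eq_fin_class:
  assumes "f \<in> int_seqs"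
  shows "prefix_dense ({x \<in> int_seqs. eq_fin x f} - {b})"
  unfolding prefix_dense_def
proof (intro ballI allI)
  fix z :: "nat \<Rightarrow> real" and K assume z: "z \<in> int_seqs"
  \<comment> \<open>Coordinate K is spent on differing from b; afterwards e returns to f.\<close>
  define c :: real where "c = (if b K = 0 then 1 else 0)"
  define e where "e = (\<lambda>k. if k < K then z k else if k = K then c else f k)"
  have "{k. e k \<noteq> f k} \<subseteq> {..K}"
    by (auto simp: e_def)
  then have "eq_fin e f"
    unfolding eq_fin_def by (rule finite_subset) simp
  moreover have "e \<in> int_seqs"
    using z assms by (auto simp: e_def int_seqs_def c_def)
  moreover have "e K \<noteq> b K"
    by (simp add: e_def c_def)
  then have "e \<noteq> b"
    by blast
  moreover have "agree K e z"
    by (simp add: agree_def e_def)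
  ultimately show "\<exists>x\<in>{x \<in> int_seqs. eq_fin x f} - {b}. agree K x z"
    by blast
qed

section \<open>The space and its countable dense homogeneity\<close>

definition chain_space :: "(nat \<Rightarrow> real) set \<Rightarrow> (nat \<Rightarrow> real) set" where
  "chain_space C = {x \<in> int_seqs. x 0 = 0 \<or> (\<exists>f\<in>C. eq_fin x f)}"

definition below_classes :: "(nat \<Rightarrow> real) set \<Rightarrow> (nat \<Rightarrow> real) \<Rightarrow> (nat \<Rightarrow> real) set" where
  "below_classes C g = {x \<in> int_seqs. \<exists>f\<in>C. \<not> eventually_le g f \<and> eq_fin x f}"

text \<open>The condition at coordinate 0 separates these sets from the slice x 0 = 0, so points of
  the slice avoid them however fast they grow.\<close>

definition tail_above :: "(nat \<Rightarrow> real) \<Rightarrow> nat \<Rightarrow> (nat \<Rightarrow> real) set" where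
  "tail_above g m = {x. x 0 \<noteq> 0 \<and> (\<forall>k\<ge>m. g k \<le> x k)}"

lemma chain_space_subset: "chain_space C \<subseteq> int_seqs"
  and below_classes_subset: "below_classes C g \<subseteq> chain_space C"
  by (auto simp: chain_space_def below_classes_def)

lemma eventually_le_eq_fin:
  assumes "eventually_le g x" "eq_fin x y"
  shows "eventually_le g y"
proof -
  have "\<forall>\<^sub>F k in sequentially. x k = y k"
    using assms(2) by (simp add: eq_fin_def cofinite_eq_sequentially[symmetric] eventually_cofinite)
  with assms(1) show ?thesis
    unfolding eventually_le_def by eventually_elim simp
qed

lemma countable_below_classes:
  assumes "countable {f \<in> C. \<not> eventually_le g f}"
  shows "countable (below_classes C g)"
proof -
  have "below_classes C g = (\<Union>f\<in>{f \<in> C. \<not> eventually_le g f}. {x \<in> int_seqs. eq_fin x f})"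
    by (auto simp: below_classes_def)
  then show ?thesis
    using assms countable_eq_fin_class by simp
qed

lemma tail_above_cover:
  assumes "x \<in> chain_space C" "x \<notin> below_classes C g" "x 0 \<noteq> 0"
  shows "\<exists>m. x \<in> tail_above g m"
proof -
  obtain f where "f \<in> C" "eq_fin x f" "x \<in> int_seqs"
    using assms by (auto simp: chain_space_def)
  then have "eventually_le g x"
    using assms(2) eventually_le_eq_fin eq_fin_sym unfolding below_classes_def by blast
  then show ?thesis
    using assms(3) by (auto simp: tail_above_def eventually_le_def eventually_sequentially)
qed

text \<open>On the slice coordinate 0 separates z from the set; otherwise some coordinate k \<ge> m
  with z k < g k does.\<close>

lemma avoids_tail_above:
  assumes "z 0 = 0 \<or> \<not> eventually_le g z"
  shows "avoids (tail_above g m) z"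
proof (cases "z 0 = 0")
  case True
  then have "\<not> agree 1 x z" if "x \<in> tail_above g m" for x
    using that by (auto simp: tail_above_def agree_def)
  then show ?thesis
    unfolding avoids_def by blast
next
  case False
  then obtain k where "m \<le> k" "z k < g k"
    using assms by (auto simp: eventually_le_def eventually_sequentially not_le)
  then have "\<not> agree (Suc k) x z" if "x \<in> tail_above g m" for x
    using that by (fastforce simp: tail_above_def agree_def)
  then show ?thesis
    unfolding avoids_def by blast
qed

lemma eq_fin_class_disjoint_tail_above:
  assumes "\<not> eventually_le g f" "eq_fin x f"
  shows "x \<notin> tail_above g m"
proof
  assume "x \<in> tail_above g m"
  then have "eventually_le g x"
    by (auto simp: tail_above_def eventually_le_def eventually_sequentially)
  then show False
    using assms eventually_le_eq_fin by blast
qed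

lemma prefix_dense_class:
  assumes "f \<in> int_seqs"
  shows "prefix_dense {x \<in> int_seqs. eq_fin x f}"
  using prefix_dense_eq_fin_class[OF assms] prefix_dense_mono by blast

lemma CDH_chain_space:
  assumes C: "C \<subseteq> int_seqs" "uncountable C"
    and bd: "\<And>H. countable H \<Longrightarrow> H \<subseteq> C \<Longrightarrow>
       \<exists>g. (\<forall>x\<in>H. \<not> eventually_le g x) \<and> countable {x \<in> C. \<not> eventually_le g x}"
  shows "CDH (top_of_set (chain_space C))"
  unfolding CDH_def
proof (intro allI impI, elim conjE)
  let ?X = "chain_space C" and ?cl = "\<lambda>f. {x \<in> int_seqs. eq_fin x f}"
  fix D E assume DE: "countable D" "D \<subseteq> topspace (top_of_set ?X)" "countable E" "E \<subseteq> topspace (top_of_set ?X)"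
    and dense: "top_of_set ?X closure_of D = topspace (top_of_set ?X)"
      "top_of_set ?X closure_of E = topspace (top_of_set ?X)"
  define H where "H = {f \<in> C. \<exists>x\<in>D \<union> E. eq_fin x f}"
  have "H \<subseteq> (\<Union>x\<in>D \<union> E. ?cl x)"
    using C by (auto simp: H_def dest: eq_fin_sym)
  moreover have "countable (\<Union>x\<in>D \<union> E. ?cl x)"
    using DE countable_eq_fin_class by (intro countable_UN) auto
  ultimately have "countable H"
    using countable_subset by blast
  \<comment> \<open>A class disjoint from D and E is put into S to make both S - D and S - E
    dense.\<close>
  then have "\<not> C \<subseteq> H"
    using C(2) countable_subset by blast
  then obtain f where f: "f \<in> C" "f \<notin> H"
    by blast
  have "countable (insert f H)" "insert f H \<subseteq> C"
    using \<open>countable H\<close> f by (auto simp: H_def)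
  \<comment> \<open>Escaping f and every member of H ensures that the off-slice points of S are not
    eventually above g.\<close>
  from bd[OF this] obtain g where g0: "\<forall>x\<in>insert f H. \<not> eventually_le g x"
      and g: "countable {x \<in> C. \<not> eventually_le g x}"
    by blast
  define S where "S = D \<union> E \<union> below_classes C g"
  have SX: "S \<subseteq> ?X"
    using DE below_classes_subset by (auto simp: S_def)
  have cS: "countable S"
    using DE countable_below_classes[OF g] by (simp add: S_def)
  have cl: "?cl f \<subseteq> S - (D \<union> E)"
    using f g0 by (auto simp: S_def below_classes_def H_def)
  have fint: "f \<in> int_seqs"
    using f C by blast
  have "prefix_dense ?X"
    by (rule prefix_dense_mono[OF prefix_dense_class[OF fint]]) (use cl SX in blast)
  then have pd: "prefix_dense D" "prefix_dense E"
    using prefix_dense_if_dense[OF chain_space_subset] dense by blast+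
  have pd': "prefix_dense (S - D)" "prefix_dense (S - E)"
    by (rule prefix_dense_mono[OF prefix_dense_class[OF fint]]; use cl in blast)+
  \<comment> \<open>Finite modifications are included because the back-and-forth must also control
    the provisional image of a point.\<close>
  have av: "avoids (tail_above g m) z" if "d \<in> S" "eq_fin z d" "z 0 = d 0" for d z m
  proof (rule avoids_tail_above)
    have "d 0 = 0 \<or> \<not> eventually_le g d"
    proof (cases "d \<in> below_classes C g")
      case True
      then show ?thesis
        using eventually_le_eq_fin by (auto simp: below_classes_def)
    next
      case False
      then have d: "d \<in> D \<union> E" "d \<in> ?X"
        using that(1) SX by (auto simp: S_def)
      show ?thesis
      proof (cases "d 0 = 0")
        case nz: False
        then obtain h where h: "h \<in> C" "eq_fin d h"
          using d(2) by (auto simp: chain_space_def)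
        then have "h \<in> H"
          using d(1) by (auto simp: H_def)
        then show ?thesis
          using g0 h eventually_le_eq_fin by blast
      qed simp
    qed
    then show "z 0 = 0 \<or> \<not> eventually_le g z"
      using that(2,3) eventually_le_eq_fin by metis
  qed
  have S: "S \<subseteq> int_seqs" "D \<subseteq> S" "E \<subseteq> S"
    using subset_trans[OF SX chain_space_subset] by (auto simp: S_def)
  obtain R where R: "coherent R" "R \<subseteq> S \<times> S" "fst ` R = S" "snd ` R = S"
    "\<And>d e. (d, e) \<in> R \<Longrightarrow> d \<in> D \<longleftrightarrow> e \<in> E"
    "\<And>d e. (d, e) \<in> R \<Longrightarrow> e 0 = d 0"
    "\<And>m x. x \<in> tail_above g m \<Longrightarrow> finite {k. offset R x k \<noteq> 0}"
    "\<And>m x. x \<in> tail_above g m \<Longrightarrow> finite {k. offset (R\<inverse>) x k \<noteq> 0}"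
  proof (rule back_and_forth[OF cS S(1,2) pd(1) pd'(1) S(3) pd(2) pd'(2)])
    show "avoids (tail_above g m) z" if "d \<in> S" "eq_fin z d" "z 0 = d 0" for d z m
      using av that .
  qed (rule that)
  \<comment> \<open>Stated for a general Q to cover R and its converse. Points of S go to S and
    points of the slice keep coordinate 0. All others lie in some \<open>tail_above g m\<close>, so
    they change finitely often and stay in their class.\<close>
  have act_X: "act Q x \<in> ?X"
    if Q: "coherent Q" "Q \<subseteq> S \<times> S" "fst ` Q = S" "\<And>d e. (d, e) \<in> Q \<Longrightarrow> e 0 = d 0"
      "\<And>m x. x \<in> tail_above g m \<Longrightarrow> finite {k. offset Q x k \<noteq> 0}" and x: "x \<in> ?X" for Q x
  proof (cases "x \<in> S")
    case True
    then obtain e where "(x, e) \<in> Q"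
      using Q(3) by force
    then show ?thesis
      using act_pair[OF Q(1)] Q(2) SX by blast
  next
    case False
    have int: "act Q x \<in> int_seqs"
      using act_int_seqs[OF Q(1)] Q(2) SX chain_space_subset x by blast
    show ?thesis
    proof (cases "x 0 = 0")
      case True
      have "offset Q x 0 = 0"
      proof (rule ccontr)
        assume "offset Q x 0 \<noteq> 0"
        then obtain d e where "(d, e) \<in> Q" "agree 0 d x"
          by (rule offset_nonzeroE)
        then show False
          using offset_eq[OF Q(1), of d e 0 x] Q(4) \<open>offset Q x 0 \<noteq> 0\<close> by simp
      qed
      then show ?thesis
        using True int by (simp add: chain_space_def act_def)
    next
      case nz: False
      then obtain m where "x \<in> tail_above g m"
        using tail_above_cover[OF x] False by (auto simp: S_def)
      then have "eq_fin (act Q x) x"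
        using Q(5) eq_fin_act by blast
      moreover obtain h where "h \<in> C" "eq_fin x h"
        using nz x by (auto simp: chain_space_def)
      ultimately have "eq_fin (act Q x) h"
        using eq_fin_trans by blast
      then show ?thesis
        using \<open>h \<in> C\<close> int by (auto simp: chain_space_def)
    qed
  qed
  have R1: "act R x \<in> ?X" if "x \<in> ?X" for x
    by (rule act_X[OF R(1-3) _ _ that]) (use R(6,7) in auto)
  have R2: "act (R\<inverse>) x \<in> ?X" if "x \<in> ?X" for x
  proof (rule act_X[OF coherent_converse[OF R(1)] _ _ _ _ that])
    show "R\<inverse> \<subseteq> S \<times> S" "fst ` R\<inverse> = S"
      using R(2,4) by force+
    show "e 0 = d 0" if "(d, e) \<in> R\<inverse>" for d e
      using that R(6)[of e d] by simp
  qed (use R(8) in auto)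
  have "homeomorphic_maps (top_of_set ?X) (top_of_set ?X) (act R) (act (R\<inverse>))"
    unfolding homeomorphic_maps_def
    by (intro conjI continuous_map_agree chain_space_subset)
      (auto simp: R1 R2 agree_act_iff act_converse_act act_act_converse R(1))
  then have "homeomorphic_map (top_of_set ?X) (top_of_set ?X) (act R)"
    using homeomorphic_maps_map by blast
  moreover have "act R ` D = E"
  proof
    show "act R ` D \<subseteq> E"
    proof safe
      fix d assume "d \<in> D"
      then obtain e where "(d, e) \<in> R"
        using R(3) S_def by force
      then show "act R d \<in> E"
        using act_pair[OF R(1)] R(5) \<open>d \<in> D\<close> by metis
    qed
    show "E \<subseteq> act R ` D"
    proof
      fix e assume "e \<in> E"
      then obtain d where "(d, e) \<in> R"
        using R(4) S_def by force
      then show "e \<in> act R ` D"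
        using act_pair[OF R(1)] R(5) \<open>e \<in> E\<close> by (metis imageI)
    qed
  qed
  ultimately show "\<exists>h. homeomorphic_map (top_of_set ?X) (top_of_set ?X) h \<and> h ` D = E"
    by blast
qed

section \<open>The square\<close>

lemma not_CDH_square_chain_space:
  assumes C: "C \<subseteq> int_seqs" and f: "f \<in> C" "\<not> eventually_le g f"
    and cg: "countable {x \<in> C. \<not> eventually_le g x}"
  shows "\<not> CDH (prod_topology (top_of_set (chain_space C)) (top_of_set (chain_space C)))"
proof
  let ?X = "chain_space C"
  let ?T = "top_of_set ?X" and ?T2 = "prod_topology (top_of_set ?X) (top_of_set ?X)"
  assume cdh: "CDH ?T2"
  define Q where "Q = {x \<in> int_seqs. eq_fin x f}"
  define N where "N = below_classes C g"
  define A where "A = {x \<in> int_seqs. x 0 = 0}"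
  \<comment> \<open>The points whose last disagreement with f is at k: these sets are closed in
    \<open>int_seqs\<close> and pairwise disjoint.\<close>
  define T where "T k = {x \<in> int_seqs. x k \<noteq> f k \<and> (\<forall>j>k. x j = f j)}" for k
  \<comment> \<open>countable, dense and with all sections closed, unlike Q \<times> Q\<close>
  define D where "D = (\<Union>k. T k \<times> T k)"
  \<comment> \<open>Countably many closed sets that cover the space off the slice; each one misses a
    dense subset of Q.\<close>
  define \<B> where "\<B> = (\<lambda>b. {b}) ` N \<union> range (\<lambda>m. tail_above g m \<inter> ?X)"
  have fint: "f \<in> int_seqs"
    using C f by blast
  have QN: "Q \<subseteq> N"
    using f by (auto simp: Q_def N_def below_classes_def)
  have NX: "N \<subseteq> ?X"
    using below_classes_subset by (simp add: N_def)
  have AX: "A \<subseteq> ?X"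
    by (auto simp: A_def chain_space_def)
  have TQ: "T k \<subseteq> Q" for k
  proof
    fix x assume x: "x \<in> T k"
    then have "{j. x j \<noteq> f j} \<subseteq> {..k}"
      by (auto simp: T_def not_le[symmetric])
    then have "eq_fin x f"
      unfolding eq_fin_def by (rule finite_subset) simp
    then show "x \<in> Q"
      using x by (simp add: T_def Q_def)
  qed
  have cQ: "countable Q" and cN: "countable N"
    using countable_eq_fin_class countable_below_classes[OF cg] by (auto simp: Q_def N_def)
  have pdQ: "prefix_dense (Q - {b})" for b
    using prefix_dense_eq_fin_class[OF fint] by (simp add: Q_def)
  have pdX: "prefix_dense ?X"
    by (rule prefix_dense_mono[OF pdQ]) (use QN NX in blast)
  have Q_above: "x \<notin> tail_above g m" if "x \<in> Q" for x m
    using eq_fin_class_disjoint_tail_above[OF f(2)] that by (simp add: Q_def)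
  have cB: "countable \<B>"
    using cN by (simp add: \<B>_def)
  have clB: "closedin ?T B" if "B \<in> \<B>" for B
  proof -
    have "closedin ?T (tail_above g m \<inter> ?X)" for m
      unfolding closedin_int_seqs[OF chain_space_subset]
    proof (intro conjI ballI)
      fix x assume x: "x \<in> ?X - tail_above g m \<inter> ?X"
      then have "x 0 = 0 \<or> (\<exists>k\<ge>m. x k < g k)"
        by (auto simp: tail_above_def not_le)
      then obtain k where "x 0 = 0 \<or> k \<ge> m \<and> x k < g k"
        by blast
      then have "\<forall>y\<in>?X. agree (Suc k) y x \<longrightarrow> y \<notin> tail_above g m \<inter> ?X"
        by (auto simp: tail_above_def agree_def not_le[symmetric])
      then show "\<exists>K. \<forall>y\<in>?X. agree K y x \<longrightarrow> y \<notin> tail_above g m \<inter> ?X"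
        by blast
    qed auto
    then show ?thesis
      using that NX by (auto simp: \<B>_def)
  qed
  have B_thin: "\<exists>y\<in>Q. agree K y x \<and> y \<notin> B" if B: "B \<in> \<B>" and x: "x \<in> int_seqs" for B x K
  proof -
    obtain b where "B = {b} \<or> (\<exists>m. B = tail_above g m \<inter> ?X)"
      using B by (auto simp: \<B>_def)
    moreover obtain y where "y \<in> Q - {b}" "agree K y x"
      using pdQ x unfolding prefix_dense_def by blast
    ultimately show ?thesis
      using Q_above by blast
  qed
  have B_cover: "x \<in> \<Union>\<B>" if "x \<in> ?X" "x 0 \<noteq> 0" for x
    using tail_above_cover[OF that(1) _ that(2), of g] that(1) by (auto simp: \<B>_def N_def)
  have D_Q: "D \<subseteq> Q \<times> Q"
    using TQ by (auto simp: D_def)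
  have QX: "Q \<times> Q \<subseteq> ?X \<times> ?X"
    using QN NX by blast
  have D_dense: "\<exists>x' y'. (x', y') \<in> D \<and> agree K x' x \<and> agree K y' y"
    if "x \<in> int_seqs" "y \<in> int_seqs" for x y K
  proof -
    \<comment> \<open>Both modified points have K as last disagreement with f, so they form a pair
      in D.\<close>
    define e where "e u = (\<lambda>k. if k < K then u k else if k = K then f K + 1 else f k)" for u :: "nat \<Rightarrow> real"
    have "e u \<in> T K" "agree K (e u) u" if "u \<in> int_seqs" for u
      using that fint by (auto simp: e_def T_def int_seqs_def agree_def)
    then show ?thesis
      using that unfolding D_def by blast
  qed
  have dense: "?T2 closure_of S = topspace ?T2" if "D \<subseteq> S" for S
    unfolding dense_intersects_open
  proof (intro allI impI, elim conjE)
    fix U assume U: "openin ?T2 U" "U \<noteq> {}"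
    then obtain x y where xy: "(x, y) \<in> U"
      by auto
    then have xyX: "x \<in> ?X" "y \<in> ?X"
      using openin_subset[OF U(1)] by auto
    obtain K where K: "\<And>x' y'. x' \<in> ?X \<Longrightarrow> y' \<in> ?X \<Longrightarrow> agree K x' x \<Longrightarrow> agree K y' y \<Longrightarrow> (x', y') \<in> U"
      using openin_prod_int_seqs[OF chain_space_subset U(1) xy] by blast
    obtain x' y' where "(x', y') \<in> D" "agree K x' x" "agree K y' y"
      using D_dense xyX chain_space_subset by blast
    then have "(x', y') \<in> U" "(x', y') \<in> S"
      using K D_Q QX that by blast+
    then show "S \<inter> U \<noteq> {}"
      by blast
  qed
  have cQQ: "countable (Q \<times> Q)"
    using cQ by simp
  then have cD: "countable D"
    using D_Q countable_subset by blast
  have DX: "D \<subseteq> topspace ?T2" "Q \<times> Q \<subseteq> topspace ?T2"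
    using subset_trans[OF D_Q QX] QX by simp_all
  obtain h where h: "homeomorphic_map ?T2 ?T2 h" "h ` D = Q \<times> Q"
    using cdh[unfolded CDH_def, rule_format, of D "Q \<times> Q"] cD cQQ DX
      dense[OF subset_refl] dense[OF D_Q] by blast
  then obtain h' where hh: "homeomorphic_maps ?T2 ?T2 h h'"
    using homeomorphic_map_maps by blast
  have cont: "continuous_map ?T2 ?T2 h" "continuous_map ?T2 ?T2 h'"
    using hh by (auto simp: homeomorphic_maps_def)
  have h'h: "h' (h p) = p" "h (h' p) = p" "h p \<in> ?X \<times> ?X" "h' p \<in> ?X \<times> ?X" if "p \<in> ?X \<times> ?X" for p
    using hh that cont by (auto simp: homeomorphic_maps_def continuous_map_def)
  have A_op: "openin ?T A"
  proof -
    have "A = {y \<in> ?X. agree 1 y (\<lambda>_. 0)}"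
      using AX chain_space_subset by (auto simp: A_def agree_def)
    then show ?thesis
      using openin_cylinder[OF chain_space_subset] by metis
  qed
  have TA: "subtopology ?T A = top_of_set A"
    using AX by (simp add: subtopology_subtopology inf_absorb2)
  have cmA: "completely_metrizable_space (top_of_set A)"
    using completely_metrizable_slice by (simp add: A_def)
  let ?Y = "subtopology ?T2 (A \<times> A)"
  have cmY: "completely_metrizable_space ?Y"
    unfolding subtopology_Times TA using cmA completely_metrizable_space_prod_topology by blast
  have csnd: "continuous_map ?Y ?T (snd \<circ> h)"
    by (rule continuous_map_compose[OF continuous_map_from_subtopology[OF cont(1)] continuous_map_snd])
  \<comment> \<open>A \<times> A is Baire, while the points whose second coordinate lies off A form a meager open set\<close>
  have slice: "snd (h p) 0 = 0" if p: "p \<in> A \<times> A" for p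
  proof (rule ccontr)
    assume nz: "snd (h p) 0 \<noteq> 0"
    let ?G = "(\<lambda>B. {p \<in> A \<times> A. snd (h p) \<in> B}) ` \<B>"
    have "?Y interior_of \<Union>?G = {}"
    proof (rule Baire_category_alt)
      fix G assume "G \<in> ?G"
      then obtain B where B: "B \<in> \<B>" "G = {p \<in> A \<times> A. snd (h p) \<in> B}"
        by blast
      have ts: "topspace ?Y = A \<times> A"
        using AX by auto
      have "closedin ?Y {p \<in> topspace ?Y. (snd \<circ> h) p \<in> B}"
        using csnd clB[OF B(1)] by (rule closedin_continuous_map_preimage)
      then have "closedin ?Y G"
        by (simp only: ts B(2) o_def)
      moreover have "W = {}" if W: "openin ?Y W" "W \<subseteq> G" for W
      proof (rule ccontr)
        assume "W \<noteq> {}"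
        then obtain w where w: "w \<in> W"
          by blast
        have "openin ?T2 (A \<times> A)"
          unfolding openin_prod_Times_iff using A_op by blast
        then have "openin ?T2 W"
          using W(1) openin_trans_full by blast
        \<comment> \<open>The image of W is open, so changing only the second coordinate of h w can
          reach a point of Q outside B without leaving it.\<close>
        then have op: "openin ?T2 (h ` W)"
          using h(1) homeomorphic_imp_open_map open_map_def by blast
        obtain u v where uv: "h w = (u, v)"
          by fastforce
        then have "(u, v) \<in> h ` W"
          using w by force
        then obtain K where K: "\<And>x' y'. x' \<in> ?X \<Longrightarrow> y' \<in> ?X \<Longrightarrow> agree K x' u \<Longrightarrow> agree K y' v \<Longrightarrow> (x', y') \<in> h ` W"
          using openin_prod_int_seqs[OF chain_space_subset op] by blast
        have uvX: "u \<in> ?X" "v \<in> ?X"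
          using openin_subset[OF op] \<open>(u, v) \<in> h ` W\<close> by auto
        then obtain v' where v': "v' \<in> Q" "agree K v' v" "v' \<notin> B"
          using B_thin[OF B(1)] chain_space_subset by blast
        then have "(u, v') \<in> h ` W"
          using K[of u v'] uvX QN NX by auto
        then obtain p where "p \<in> W" "h p = (u, v')"
          by fastforce
        then show False
          using W(2) B(2) v'(3) by auto
      qed
      from this[OF openin_interior_of interior_of_subset] have "?Y interior_of G = {}" .
      ultimately show "closedin ?Y G \<and> ?Y interior_of G = {}"
        by blast
    qed (use cmY cB in auto)
    moreover have "openin ?Y {p \<in> topspace ?Y. (snd \<circ> h) p \<in> ?X - A}"
    proof (rule openin_continuous_map_preimage)
      show "continuous_map ?Y ?T (snd \<circ> h)"
        by (rule csnd)
      have "?X - A = ?X - {y \<in> ?X. agree 1 y (\<lambda>_. 0)}"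
        using chain_space_subset by (auto simp: A_def agree_def)
      then show "openin ?T (?X - A)"
        using closedin_cylinder[OF chain_space_subset, of C 1 "\<lambda>_. 0"] openin_diff[OF openin_topspace] by fastforce
    qed
    moreover have "p \<in> {p \<in> topspace ?Y. (snd \<circ> h) p \<in> ?X - A}"
      using p nz h'h(3)[of p] AX by (auto simp: A_def mem_Times_iff)
    moreover have "{p \<in> topspace ?Y. (snd \<circ> h) p \<in> ?X - A} \<subseteq> \<Union>?G"
    proof
      fix p assume "p \<in> {p \<in> topspace ?Y. (snd \<circ> h) p \<in> ?X - A}"
      then have "p \<in> A \<times> A" "snd (h p) \<in> ?X" "snd (h p) \<notin> A"
        by auto
      moreover then have "snd (h p) \<in> \<Union>\<B>"
        using B_cover chain_space_subset by (auto simp: A_def)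
      ultimately show "p \<in> \<Union>?G"
        by blast
    qed
    ultimately show False
      using interior_of_maximal by blast
  qed
  \<comment> \<open>A point of Q off the slice: by the category argument just given, the preimage of
    A \<times> {b} under h misses A \<times> A.\<close>
  define b where "b = f(0 := 1)"
  have b: "b \<in> Q" "b 0 \<noteq> 0"
  proof -
    have "{k. b k \<noteq> f k} \<subseteq> {0}"
      by (auto simp: b_def)
    then have "eq_fin b f"
      unfolding eq_fin_def by (rule finite_subset) simp
    then show "b \<in> Q" "b 0 \<noteq> 0"
      using fint by (auto simp: b_def Q_def int_seqs_def)
  qed
  \<comment> \<open>Closed rectangles missing D, with cylinders centred in Q to keep the family
    countable. Covering the rest of the complement of A \<times> A by them exhibits D as a G_delta
    there.\<close>
  define \<Z> where "\<Z> = {Z. Z \<inter> D = {} \<and> (\<exists>q\<in>Q. \<exists>n. \<exists>B\<in>\<B>. Z = {x \<in> ?X. agree n x q} \<times> B \<or> Z = B \<times> {x \<in> ?X. agree n x q})}"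
  have cZ: "countable \<Z>"
  proof -
    have "\<Z> \<subseteq> (\<lambda>(q, n, B). {x \<in> ?X. agree n x q} \<times> B) ` (Q \<times> UNIV \<times> \<B>)
       \<union> (\<lambda>(q, n, B). B \<times> {x \<in> ?X. agree n x q}) ` (Q \<times> UNIV \<times> \<B>)"
      by (auto simp: \<Z>_def)
    then show ?thesis
      by (rule countable_subset) (use cQ cB in auto)
  qed
  have clZ: "closedin ?T2 Z" if "Z \<in> \<Z>" for Z
  proof -
    obtain q n B where "B \<in> \<B>" and Z: "Z = {x \<in> ?X. agree n x q} \<times> B \<or> Z = B \<times> {x \<in> ?X. agree n x q}"
      using \<open>Z \<in> \<Z>\<close> unfolding \<Z>_def by blast
    then have "closedin ?T B" "closedin ?T {x \<in> ?X. agree n x q}"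
      using clB closedin_cylinder[OF chain_space_subset] by blast+
    then have "closedin ?T2 ({x \<in> ?X. agree n x q} \<times> B)" "closedin ?T2 (B \<times> {x \<in> ?X. agree n x q})"
      unfolding closedin_prod_Times_iff by blast+
    then show ?thesis
      using Z by blast
  qed
  \<comment> \<open>The section of D at y is T k when y lies in T k, with k unique, and is empty
    otherwise. Hence it is closed.\<close>
  have section_open: "\<exists>n. \<forall>x'. agree n x' x \<longrightarrow> (x', y) \<notin> D" if xy: "(x, y) \<notin> D" "x \<in> int_seqs" for x y
  proof (cases "\<exists>k. y \<in> T k")
    case True
    then obtain k where k: "y \<in> T k"
      by blast
    have uniq: "k' = k" if "y \<in> T k'" for k'
      using k that by (metis (mono_tags, lifting) T_def linorder_neqE_nat mem_Collect_eq)
    have "x \<notin> T k"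
      using k xy(1) by (auto simp: D_def)
    then obtain j where "x k = f k \<or> j > k \<and> x j \<noteq> f j"
      using xy(2) by (auto simp: T_def)
    then have "x' \<notin> T k" if "agree (Suc (k + j)) x' x" for x'
      using that by (auto simp: T_def agree_def)
    then show ?thesis
      using uniq unfolding D_def by blast
  qed (auto simp: D_def)
  have D_sym: "(x, y) \<in> D \<longleftrightarrow> (y, x) \<in> D" for x y
    by (auto simp: D_def)
  \<comment> \<open>If B is the singleton of y, the closed section at y supplies the cylinder.
    Otherwise B lies in some \<open>tail_above g m\<close> and misses Q, so every rectangle with
    side B misses D.\<close>
  have B_ex: "\<exists>q\<in>Q. \<exists>n. \<exists>B\<in>\<B>. x \<in> {x \<in> ?X. agree n x q} \<and> y \<in> B \<and> ({x \<in> ?X. agree n x q} \<times> B) \<inter> D = {}"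
    if xy: "x \<in> ?X" "y \<in> \<Union>\<B>" "(x, y) \<notin> D" for x y
  proof -
    obtain B where B: "B \<in> \<B>" "y \<in> B" "B = {y} \<or> (\<exists>m. B \<subseteq> tail_above g m)"
      using xy(2) by (auto simp: \<B>_def)
    obtain n where n: "\<forall>x'. agree n x' x \<longrightarrow> (x', y) \<notin> D"
      using section_open xy(1,3) chain_space_subset by blast
    obtain q where q: "q \<in> Q" "agree n q x"
      using pdQ xy(1) chain_space_subset unfolding prefix_dense_def by blast
    have "({x \<in> ?X. agree n x q} \<times> B) \<inter> D = {}"
    proof (cases "B = {y}")
      case True
      then show ?thesis
        using n q(2) agree_trans by blast
    next
      case False
      then show ?thesis
        using B(3) D_Q Q_above by blast
    qed
    moreover have "x \<in> {x \<in> ?X. agree n x q}"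
      using xy(1) agree_sym[OF q(2)] by blast
    ultimately show ?thesis
      using B(1,2) q(1) by blast
  qed
  have Z_cover: "(x, y) \<in> D \<union> \<Union>\<Z>" if "x \<in> ?X" "y \<in> ?X" "x 0 \<noteq> 0 \<or> y 0 \<noteq> 0" for x y
  proof (cases "(x, y) \<in> D")
    case nD: False
    show ?thesis
    proof (cases "y 0 \<noteq> 0")
      case True
      from B_ex[OF that(1) B_cover[OF that(2) True] nD] obtain q n B where
        "q \<in> Q" "B \<in> \<B>" "(x, y) \<in> {x \<in> ?X. agree n x q} \<times> B" "({x \<in> ?X. agree n x q} \<times> B) \<inter> D = {}"
        by blast
      then show ?thesis
        unfolding \<Z>_def by blast
    next
      case False
      \<comment> \<open>Now the first coordinate is off the slice, and symmetry of D allows the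
        roles to be exchanged.\<close>
      then have "x 0 \<noteq> 0" "(y, x) \<notin> D"
        using that nD D_sym by auto
      from B_ex[OF that(2) B_cover[OF that(1) this(1)] this(2)] obtain q n B where
        qB: "q \<in> Q" "B \<in> \<B>" "(x, y) \<in> B \<times> {x \<in> ?X. agree n x q}" "({x \<in> ?X. agree n x q} \<times> B) \<inter> D = {}"
        by blast
      then have "(B \<times> {x \<in> ?X. agree n x q}) \<inter> D = {}"
        using D_sym by blast
      then show ?thesis
        using qB unfolding \<Z>_def by blast
    qed
  qed simp
  \<comment> \<open>Pulled back to A, the rectangles become closed sets missing Q \<inter> A, since
    (q, b) lies in the image of D for every q in Q. Together with the singletons of Q \<inter> A
    they will cover A.\<close>
  let ?e = "\<lambda>a. h' (a, b)"
  let ?H = "(\<lambda>Z. {a \<in> A. ?e a \<in> Z}) ` \<Z> \<union> (\<lambda>q. {q}) ` (Q \<inter> A)"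
  have bX: "b \<in> ?X"
    using b QN NX by blast
  have A_dense: "\<exists>q\<in>Q \<inter> W. q \<noteq> r" if W: "openin (top_of_set A) W" "a \<in> W" for W a r
  proof -
    have Aint: "A \<subseteq> int_seqs"
      by (auto simp: A_def)
    obtain K where K: "\<forall>y\<in>A. agree K y a \<longrightarrow> y \<in> W" and a: "a \<in> A"
      using W unfolding openin_int_seqs[OF Aint] by blast
    \<comment> \<open>Length \<open>Suc K\<close> forces agreement at coordinate 0, which keeps q in
      A.\<close>
    obtain q where q: "q \<in> Q - {r}" "agree (Suc K) q a"
      using pdQ a unfolding prefix_dense_def A_def by blast
    then have "q \<in> A" "agree K q a"
      using a by (auto simp: A_def Q_def agree_def)
    then show ?thesis
      using K q by blast
  qed
  have ce: "continuous_map (top_of_set A) ?T2 ?e"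
  proof -
    have "continuous_map (top_of_set A) ?T2 (\<lambda>a. (a, b))"
      using AX bX by (auto intro!: continuous_intros simp: continuous_map_in_subtopology)
    from continuous_map_compose[OF this cont(2)] show ?thesis
      by (simp only: o_def)
  qed
  have "top_of_set A interior_of \<Union>?H = {}"
  proof (rule Baire_category_alt)
    show "countable ?H"
      using cZ cQ by simp
    fix G assume "G \<in> ?H"
    then consider Z where "Z \<in> \<Z>" "G = {a \<in> A. ?e a \<in> Z}" | q where "q \<in> Q \<inter> A" "G = {q}"
      by blast
    then show "closedin (top_of_set A) G \<and> top_of_set A interior_of G = {}"
    proof cases
      case 1
      have "closedin (top_of_set A) {a \<in> topspace (top_of_set A). ?e a \<in> Z}"
        using closedin_continuous_map_preimage[OF ce clZ[OF 1(1)]] .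
      moreover have "W = {}" if W: "openin (top_of_set A) W" "W \<subseteq> G" for W
      proof (rule ccontr)
        assume "W \<noteq> {}"
        then obtain q where q: "q \<in> Q" "q \<in> W"
          using A_dense[OF W(1)] by blast
        then have "(q, b) \<in> h ` D"
          using h(2) b by blast
        then obtain d where d: "d \<in> D" "(q, b) = h d"
          by blast
        then have "?e q = d"
          using h'h(1) D_Q QX by (metis subsetD)
        then have "d \<in> Z"
          using q W(2) 1(2) by blast
        then show False
          using d(1) 1(1) by (auto simp: \<Z>_def)
      qed
      from this[OF openin_interior_of interior_of_subset] have "top_of_set A interior_of G = {}" .
      ultimately show ?thesis
        using 1(2) by simp
    next
      case 2
      have "W = {}" if W: "openin (top_of_set A) W" "W \<subseteq> G" for W
        using A_dense[OF W(1), of _ q] W(2) 2(2) by blast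
      from this[OF openin_interior_of interior_of_subset] have "top_of_set A interior_of G = {}" .
      then show ?thesis
        using 2 by simp
    qed
  qed (use cmA in simp)
  moreover have "A \<subseteq> \<Union>?H"
  proof
    fix a assume a: "a \<in> A"
    have ab: "(a, b) \<in> ?X \<times> ?X"
      using a AX bX by blast
    obtain x y where xy: "?e a = (x, y)"
      by fastforce
    have xyX: "x \<in> ?X" "y \<in> ?X"
      using h'h(4)[OF ab] xy by auto
    have hxy: "h (x, y) = (a, b)"
      using h'h(2)[OF ab] xy by simp
    have "x 0 \<noteq> 0 \<or> y 0 \<noteq> 0"
    proof (rule ccontr)
      assume "\<not> ?thesis"
      then have "(x, y) \<in> A \<times> A"
        using xyX chain_space_subset by (auto simp: A_def)
      then show False
        using slice[of "(x, y)"] hxy b(2) by simp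
    qed
    then have "(x, y) \<in> D \<union> \<Union>\<Z>"
      by (rule Z_cover[OF xyX])
    then show "a \<in> \<Union>?H"
    proof
      assume "(x, y) \<in> D"
      then have "(a, b) \<in> Q \<times> Q"
        using h(2) hxy by (metis imageI)
      then show ?thesis
        using a by blast
    next
      assume "(x, y) \<in> \<Union>\<Z>"
      then obtain Z where "Z \<in> \<Z>" "?e a \<in> Z"
        using xy by auto
      then show ?thesis
        using a by blast
    qed
  qed
  ultimately have "A = {}"
    using interior_of_maximal[of A "\<Union>?H" "top_of_set A"] by auto
  moreover have "(\<lambda>_. 0) \<in> A"
    by (simp add: A_def int_seqs_def)
  ultimately show False
    by blast
qed

section \<open>Separability and assembly of the example\<close>

lemma second_countable_euclidean: "second_countable (euclidean :: 'a::second_countable_topology topology)"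
proof -
  obtain B :: "'a set set" where "countable B" "topological_basis B"
    using ex_countable_basis by blast
  moreover have "\<forall>V\<in>B. open V"
    using topological_basis_open[OF \<open>topological_basis B\<close>] by blast
  moreover have "\<exists>V\<in>B. x \<in> V \<and> V \<subseteq> U" if "open U" "x \<in> U" for U x
    using topological_basisE[OF \<open>topological_basis B\<close> that] by metis
  ultimately show ?thesis
    unfolding second_countable_def
    by (intro exI[of _ B]) (simp add: open_openin[symmetric])
qed

theorem mainTheorem1:
  assumes "MA_sigma_centered"
  shows "\<exists>X :: (nat \<Rightarrow> real) topology.
           zero_dimensional X \<and> separable_space X \<and> metrizable_space X \<and>
           CDH X \<and> \<not> CDH (prod_topology X X)"
proof -
  obtain C :: "(nat \<Rightarrow> real) set" where C: "C \<subseteq> int_seqs" "uncountable C"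
    and bound: "\<And>H. countable H \<Longrightarrow> H \<subseteq> C \<Longrightarrow>
       \<exists>g. (\<forall>x\<in>H. \<not> eventually_le g x) \<and> countable {x \<in> C. \<not> eventually_le g x}"
    using exists_omega1_chain by metis
  obtain f where f: "f \<in> C"
    using C(2) by fastforce
  \<comment> \<open>This g puts the class of f into \<open>below_classes C g\<close> while keeping
    that set countable.\<close>
  obtain g where g: "\<not> eventually_le g f" "countable {x \<in> C. \<not> eventually_le g x}"
    using bound[of "{f}"] f by auto
  let ?X = "top_of_set (chain_space C)"
  have "zero_dimensional ?X"
    by (rule zero_dimensional_int_seqs[OF chain_space_subset])
  moreover have "separable_space ?X"
    by (intro second_countable_imp_separable_space second_countable_subtopology second_countable_euclidean)
  moreover have "metrizable_space ?X"
    by (intro metrizable_space_subtopology metrizable_space_euclidean)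
  moreover have "CDH ?X"
    by (rule CDH_chain_space[OF C bound])
  moreover have "\<not> CDH (prod_topology ?X ?X)"
    by (rule not_CDH_square_chain_space[OF C(1) f g])
  ultimately show ?thesis
    by blast
qed

end
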